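(* Let $\Delta\ge 3$ be an integer and let $\mathcal{G}$ be a class of graphs that contains all trees of maximum degree at most $\Delta$. Let $r\colon\mathbb{N}\to\mathbb{R}_0^+$ be a non-decreasing function. If $\mathcal{G}$ is fractionally $\star$-fragile at rate $r$, then $r(a)\ge(\Delta-1)^{a-3}$ for every integer $a\ge 4$.
   Context: All graphs are finite. For a graph $G$, $\star(G)$ denotes the maximum number of vertices of a connected component of $G$. For $\varepsilon>0$, a probability distribution on subsets of $V(G)$ is $\varepsilon$-thin if for each vertex $v$, the probability that $v$ belongs to a set sampled from the distribution is at most $\varepsilon$. For a graph parameter $f$ and a non-decreasing function $r\colon\mathbb{N}\to\mathbb{R}_0^+$, a graph $G$ is fractionally $f$-fragile at rate $r$ if for every positive integer $a$ there exists a $(1/a)$-thin probability distribution on the collection of sets $Y\subseteq V(G)$ satisfying $f(G-Y)\le r(a)$. A class of graphs is fractionally $f$-fragile at rate $r$ if every graph in the class is. *)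

theory Defs
  imports
    "Graph_Theory.Digraph_Component"
    "HOL-Probability.Probability_Mass_Function"
    "HOL-Library.Infinite_Typeclass"
begin

text \<open>
  Finite simple undirected graphs are the finite, symmetric, loop-free digraphs with at most one
  arc from one vertex to another (\<^locale>\<open>pair_graph\<close>): every edge is represented by its two
  orientations.
  The definitions below have their intended meaning for such graphs.
\<close>

text \<open>
  In a symmetric digraph, \<open>out_degree\<close> is the number of incident edges. The number 0 is
  inserted only so that the maximum exists for the graph without vertices; likewise for
  \<open>star\<close>.
\<close>

definition max_degree :: "('a, 'b) pre_digraph \<Rightarrow> nat" where
  "max_degree G = Max (insert 0 (out_degree G ` verts G))"

text \<open>
  The library predicate \<open>tree\<close> is not suitable for undirected graphs: going along an edge and
  back is a cycle of length 2 in the symmetric digraph, so \<open>forest\<close> allows no edge at all.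
  The cycles of an undirected simple graph are those of length at least 3.
\<close>

definition undirected_tree :: "('a, 'b) pre_digraph \<Rightarrow> bool" where
  "undirected_tree G \<longleftrightarrow>
     Digraph_Component.connected G \<and> \<not> (\<exists>p. pre_digraph.cycle G p \<and> 3 \<le> length p)"

text \<open>The strong components of a symmetric digraph are its connected components.\<close>

definition star :: "('a, 'b) pre_digraph \<Rightarrow> nat" where
  "star G = Max (insert 0 ((\<lambda>H. card (verts H)) ` pre_digraph.sccs G))"

definition thin_distribution :: "('a, 'b) pre_digraph \<Rightarrow> real \<Rightarrow> 'a set pmf \<Rightarrow> bool" where
  "thin_distribution G \<epsilon> p \<longleftrightarrow>
     set_pmf p \<subseteq> Pow (verts G) \<and>
     (\<forall>v \<in> verts G. measure_pmf.prob p {Y. v \<in> Y} \<le> \<epsilon>)"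

definition fractionally_fragile ::
  "(('a, 'b) pre_digraph \<Rightarrow> real) \<Rightarrow> (nat \<Rightarrow> real) \<Rightarrow> ('a, 'b) pre_digraph \<Rightarrow> bool" where
  "fractionally_fragile f r G \<longleftrightarrow>
     (\<forall>a > 0. \<exists>p. thin_distribution G (1 / real a) p \<and>
        (\<forall>Y \<in> set_pmf p. f (G \<restriction> (verts G - Y)) \<le> r a))"

text \<open>
  A class of graphs is a set of graphs over one vertex type. An infinite vertex type contains
  isomorphic copies of all finite graphs.
\<close>

definition class_fractionally_fragile ::
  "(('a, 'a \<times> 'a) pre_digraph \<Rightarrow> real) \<Rightarrow> (nat \<Rightarrow> real) \<Rightarrow> 'a pair_pre_digraph set \<Rightarrow> bool" where
  "class_fractionally_fragile f r \<G> \<longleftrightarrow> (\<forall>G \<in> \<G>. fractionally_fragile f r (with_proj G))"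

end

theory Submission
  imports Defs "HOL-Library.Sublist"
begin

text \<open>
  Let \<open>d = \<Delta> - 1\<close> and take the complete \<open>d\<close>-ary tree with \<open>n = a\<^sup>2\<close> levels, a vertex of depth \<open>i\<close>
  having weight \<open>1 / d ^ i\<close>, so that every level has total weight 1. By averaging, some set \<open>Y\<close> in
  the support of a \<open>(1 / a)\<close>-thin distribution has weight at most \<open>n / a = a\<close>.
  Each component of the rest has a topmost vertex, which is either the root or a child of a vertex
  of \<open>Y\<close>; the \<open>d\<close> children of a vertex together weigh as much as the vertex, so the topmost vertices
  weigh at most \<open>a + 1\<close> in total. A component with at most \<open>d ^ (m - 1)\<close> vertices weighs at most
  \<open>m\<close> times its topmost vertex. If all components had fewer than \<open>d ^ (a - 3)\<close> vertices, taking
  \<open>m = a - 2\<close> would bound the total weight \<open>a\<^sup>2\<close> by \<open>a + (a - 2) * (a + 1) = a\<^sup>2 - 2\<close>.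
\<close>

section \<open>Weights of words\<close>

text \<open>A vertex of the tree is a word; its parent is the tail of the word, and the root is \<open>[]\<close>.\<close>

definition words :: "nat \<Rightarrow> nat \<Rightarrow> nat list set" where
  "words d n = {w. set w \<subseteq> {..<d} \<and> length w < n}"

definition wt :: "nat \<Rightarrow> nat list \<Rightarrow> real" where
  "wt d w = (1 / real d) ^ length w"

lemma wt_simps [simp]:
  "wt d [] = 1" "wt d (x # w) = wt d w / real d" "wt d (u @ w) = wt d u * wt d w"
  by (simp_all add: wt_def power_add)

lemma wt_nonneg [simp]: "0 \<le> wt d w"
  by (simp add: wt_def)

lemma words_Suc: "words d (Suc n) = words d n \<union> {w. set w \<subseteq> {..<d} \<and> length w = n}"
  by (auto simp: words_def)

lemma finite_words [simp]: "finite (words d n)"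
  by (induction n) (auto simp: words_Suc finite_lists_length_eq, simp add: words_def)

lemma words_ConsD: "x # w \<in> words d n \<Longrightarrow> w \<in> words d n"
  by (auto simp: words_def)

lemma sum_wt_words:
  assumes "d > 0"
  shows "(\<Sum>w\<in>words d n. wt d w) = real n"
proof (induction n)
  case 0
  then show ?case by (simp add: words_def)
next
  case (Suc n)
  let ?L = "{w. set w \<subseteq> {..<d} \<and> length w = n}"
  have "(\<Sum>w\<in>?L. wt d w) = (\<Sum>w\<in>?L. (1 / real d) ^ n)"
    by (rule sum.cong) (auto simp: wt_def)
  also have "\<dots> = 1"
    using assms by (simp add: card_lists_length_eq field_simps)
  finally have "(\<Sum>w\<in>?L. wt d w) = 1" .
  moreover have "words d n \<inter> ?L = {}" by (auto simp: words_def)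
  ultimately show ?case
    using Suc by (simp add: words_Suc sum.union_disjoint finite_lists_length_eq)
qed

text \<open>Subtracting \<open>(1 / d) ^ m\<close> from every weight makes exactly the words shorter than \<open>m\<close>
  contribute positively.\<close>

lemma sum_wt_le:
  assumes d: "d > 0" and m: "m > 0"
    and U: "finite U" "\<And>u. u \<in> U \<Longrightarrow> set u \<subseteq> {..<d}" and card: "card U \<le> d ^ (m - 1)"
  shows "(\<Sum>u\<in>U. wt d u) \<le> real m"
proof -
  define c where "c = (1 / real d) ^ m"
  have c0: "c \<ge> 0" by (simp add: c_def)
  have pos: "c \<le> wt d u" if "length u < m" for u
    using d that unfolding c_def wt_def by (intro power_decreasing) auto
  then have pos': "c \<le> wt d u" if "u \<in> words d m" for u
    using that by (simp add: words_def)
  have neg: "wt d u \<le> c" if "\<not> length u < m" for u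
    using d that unfolding c_def wt_def by (intro power_decreasing) auto
  \<comment> \<open>The words of length \<open>m - 1\<close> alone number
    \<open>d ^ (m - 1)\<close>, so \<open>U\<close> has at most as many elements as
    \<open>words d m\<close>, and the total subtracted from \<open>U\<close> is at most that
    subtracted from \<open>words d m\<close>.\<close>
  have "{w. set w \<subseteq> {..<d} \<and> length w = m - 1} \<subseteq> words d m"
    using m by (auto simp: words_def)
  then have "card {w. set w \<subseteq> {..<d} \<and> length w = m - 1} \<le> card (words d m)"
    by (intro card_mono) auto
  then have "card U \<le> card (words d m)"
    using card by (simp add: card_lists_length_eq)
  then have cc: "c * card U \<le> c * card (words d m)"
    using c0 by (intro mult_left_mono) auto
  have "(\<Sum>u\<in>U. wt d u - c) = (\<Sum>u\<in>U \<inter> words d m. wt d u - c) + (\<Sum>u\<in>U - words d m. wt d u - c)"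
    using U(1) by (subst sum.union_disjoint [symmetric]) (auto intro!: sum.cong)
  also have "(\<Sum>u\<in>U - words d m. wt d u - c) \<le> 0"
    by (rule sum_nonpos) (use U neg in \<open>auto simp: words_def\<close>)
  also have "(\<Sum>u\<in>U \<inter> words d m. wt d u - c) + 0 \<le> (\<Sum>u\<in>words d m. wt d u - c)"
    using pos' by (auto intro!: sum_mono2)
  finally show ?thesis
    using cc d by (simp add: sum_subtractf sum_wt_words mult.commute)
qed

section \<open>Topmost vertices and the weight of a separator\<close>

text \<open>The words reached from \<open>t\<close> by going down within \<open>S\<close>, in coordinates relative to \<open>t\<close>.\<close>

definition below :: "nat list set \<Rightarrow> nat list \<Rightarrow> nat list set" where
  "below S t = {u. \<forall>v. suffix v u \<longrightarrow> v @ t \<in> S}"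

lemma below_ConsD: "x # u \<in> below S t \<Longrightarrow> u \<in> below S t"
  by (auto simp: below_def intro: suffix_ConsI)

lemma below_in: "u \<in> below S t \<Longrightarrow> u @ t \<in> S"
  by (auto simp: below_def)

lemma finite_below:
  assumes "finite S"
  shows "finite (below S t)"
proof -
  have "finite ((\<lambda>u. u @ t) -` S)"
    using assms by (intro finite_vimageI) (auto simp: inj_def)
  then show ?thesis
    by (rule rev_finite_subset) (auto dest: below_in)
qed

text \<open>Climb from \<open>w\<close> towards the root, deleting first letters, until the root is
  reached or the parent lies in \<open>Z\<close>. The climb stops at \<open>t\<close>, and
  \<open>u\<close> consists of the deleted letters.\<close>

lemma ex_top:
  assumes "w \<in> words d n - Z"
  shows "\<exists>t u. w = u @ t \<and> t \<in> words d n - Z \<and> (t = [] \<or> tl t \<in> Z) \<and> u \<in> below (words d n - Z) t"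
  using assms
proof (induction w)
  case Nil
  then show ?case by (auto simp: below_def)
next
  case (Cons x w)
  show ?case
  proof (cases "w \<in> Z")
    case True
    then show ?thesis using Cons.prems
      by (intro exI[of _ "x # w"] exI[of _ "[]"]) (auto simp: below_def)
  next
    case False
    then have "w \<in> words d n - Z" using Cons.prems words_ConsD by auto
    from Cons.IH[OF this] obtain t u where "w = u @ t" "t \<in> words d n - Z" "t = [] \<or> tl t \<in> Z"
      "u \<in> below (words d n - Z) t" by blast
    then show ?thesis using Cons.prems
      by (intro exI[of _ t] exI[of _ "x # u"]) (auto simp: below_def suffix_Cons)
  qed
qed

text \<open>Weights multiply under concatenation, so the part below a topmost vertex
  \<open>t\<close> weighs \<open>wt d t\<close> times its weight in relative coordinates, which
  \<open>sum_wt_le\<close> bounds by \<open>m\<close>.\<close>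

lemma weight_separator:
  assumes d: "d > 0" and m: "m > 0" and Z: "Z \<subseteq> words d n"
    and card: "\<And>t. t \<in> words d n - Z \<Longrightarrow> card (below (words d n - Z) t) \<le> d ^ (m - 1)"
  shows "real n \<le> sum (wt d) Z + real m * (1 + sum (wt d) Z)"
proof -
  let ?S = "words d n - Z"
  define T where "T = {t \<in> ?S. t = [] \<or> tl t \<in> Z}"
  have fZ: "finite Z" by (rule finite_subset[OF Z]) simp
  have fT: "finite T" by (simp add: T_def)
  have "T \<subseteq> insert [] ((\<lambda>(x, z). x # z) ` ({..<d} \<times> Z))"
  proof
    fix t assume "t \<in> T"
    then show "t \<in> insert [] ((\<lambda>(x, z). x # z) ` ({..<d} \<times> Z))"
      by (cases t) (auto simp: T_def words_def)
  qed
  then have "sum (wt d) T \<le> sum (wt d) (insert [] ((\<lambda>(x, z). x # z) ` ({..<d} \<times> Z)))"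
    using fZ by (intro sum_mono2) auto
  also have "\<dots> = 1 + sum (wt d) ((\<lambda>(x, z). x # z) ` ({..<d} \<times> Z))"
    using fZ by (subst sum.insert) auto
  also have "sum (wt d) ((\<lambda>(x, z). x # z) ` ({..<d} \<times> Z)) = (\<Sum>(x, z)\<in>{..<d} \<times> Z. wt d z / d)"
    by (subst sum.reindex) (auto simp: inj_on_def intro!: sum.cong)
  also have "\<dots> = sum (wt d) Z"
    using d by (simp add: sum.cartesian_product [symmetric] sum_divide_distrib [symmetric])
  finally have top: "sum (wt d) T \<le> 1 + sum (wt d) Z" .
  have fS: "finite (Sigma T (below ?S))"
    using fT by (intro finite_SigmaI finite_below) auto
  have "sum (wt d) ?S \<le> sum (wt d) ((\<lambda>(t, u). u @ t) ` Sigma T (below ?S))"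
  proof (rule sum_mono2)
    show "finite ((\<lambda>(t, u). u @ t) ` Sigma T (below ?S))"
      using fS by (rule finite_imageI)
    show "?S \<subseteq> (\<lambda>(t, u). u @ t) ` Sigma T (below ?S)"
      using ex_top[of _ d n Z] unfolding T_def by force
  qed auto
  \<comment> \<open>If several pairs \<open>(t, u)\<close> gave the same word, this would only
    enlarge the right-hand side, as weights are nonnegative.\<close>
  also have "\<dots> \<le> sum (wt d \<circ> (\<lambda>(t, u). u @ t)) (Sigma T (below ?S))"
    using fS by (intro sum_image_le) auto
  also have "\<dots> = (\<Sum>t\<in>T. \<Sum>u\<in>below ?S t. wt d u * wt d t)"
    using fT by (subst sum.Sigma) (auto intro!: finite_below sum.cong)
  also have "\<dots> \<le> (\<Sum>t\<in>T. real m * wt d t)"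
  proof (rule sum_mono)
    fix t assume t: "t \<in> T"
    have "sum (wt d) (below ?S t) \<le> real m"
    proof (rule sum_wt_le[OF d m])
      show "set u \<subseteq> {..<d}" if "u \<in> below ?S t" for u
        using below_in[OF that] by (auto simp: words_def)
    qed (use t card in \<open>auto simp: T_def intro: finite_below\<close>)
    then show "(\<Sum>u\<in>below ?S t. wt d u * wt d t) \<le> real m * wt d t"
      by (simp add: sum_distrib_right [symmetric] mult_right_mono)
  qed
  also have "\<dots> \<le> real m * (1 + sum (wt d) Z)"
    using top by (simp add: sum_distrib_left [symmetric] mult_left_mono)
  finally have "sum (wt d) ?S \<le> real m * (1 + sum (wt d) Z)" .
  moreover have "sum (wt d) ?S = real n - sum (wt d) Z"
    using Z d by (simp add: sum_diff sum_wt_words)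
  ultimately show ?thesis by simp
qed

section \<open>Averaging over a thin distribution\<close>

text \<open>Exchanging the sums over sets and vertices bounds the expected weight of a sampled set
  by \<open>\<epsilon>\<close> times the total weight. Were every set of the support heavier, the
  expectation would exceed this bound.\<close>

lemma thin_distribution_ex_light:
  assumes fin: "finite (verts G)" and p: "thin_distribution G \<epsilon> p"
    and f: "\<And>v. v \<in> verts G \<Longrightarrow> 0 \<le> (f v :: real)"
  shows "\<exists>Y\<in>set_pmf p. sum f Y \<le> \<epsilon> * sum f (verts G)"
proof (rule ccontr)
  assume neg: "\<not> ?thesis"
  have sub: "set_pmf p \<subseteq> Pow (verts G)" using p by (simp add: thin_distribution_def)
  then have finp: "finite (set_pmf p)" using fin finite_subset by auto
  have "\<epsilon> * sum f (verts G) = (\<Sum>Y\<in>set_pmf p. pmf p Y * (\<epsilon> * sum f (verts G)))"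
    using finp by (simp add: sum_distrib_right [symmetric] sum_pmf_eq_1)
  also have "\<dots> < (\<Sum>Y\<in>set_pmf p. pmf p Y * sum f Y)"
    using neg finp set_pmf_not_empty[of p]
    by (intro sum_strict_mono mult_strict_left_mono) (auto simp: pmf_positive)
  also have "\<dots> = (\<Sum>Y\<in>set_pmf p. \<Sum>v\<in>verts G. if v \<in> Y then pmf p Y * f v else 0)"
  proof (rule sum.cong)
    fix Y assume "Y \<in> set_pmf p"
    then have "verts G \<inter> Y = Y" using sub by auto
    then show "pmf p Y * sum f Y = (\<Sum>v\<in>verts G. if v \<in> Y then pmf p Y * f v else 0)"
      using fin by (simp add: sum.inter_restrict [symmetric] sum_distrib_left)
  qed simp
  also have "\<dots> = (\<Sum>v\<in>verts G. \<Sum>Y\<in>set_pmf p. if v \<in> Y then pmf p Y * f v else 0)"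
    by (rule sum.swap)
  also have "\<dots> \<le> (\<Sum>v\<in>verts G. \<epsilon> * f v)"
  proof (rule sum_mono)
    fix v assume v: "v \<in> verts G"
    have "(\<Sum>Y\<in>set_pmf p. if v \<in> Y then pmf p Y * f v else 0)
        = (\<Sum>Y\<in>set_pmf p \<inter> {Y. v \<in> Y}. pmf p Y) * f v"
      using finp by (auto simp: sum.inter_restrict sum_distrib_right intro!: sum.cong)
    also have "(\<Sum>Y\<in>set_pmf p \<inter> {Y. v \<in> Y}. pmf p Y) = measure_pmf.prob p {Y. v \<in> Y}"
      using finp by (subst measure_measure_pmf_finite [symmetric])
        (simp_all add: Int_commute [of "set_pmf p"] measure_Int_set_pmf)
    also have "\<dots> * f v \<le> \<epsilon> * f v"
      using p v f by (intro mult_right_mono) (auto simp: thin_distribution_def)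
    finally show "(\<Sum>Y\<in>set_pmf p. if v \<in> Y then pmf p Y * f v else 0) \<le> \<epsilon> * f v" .
  qed
  also have "\<dots> = \<epsilon> * sum f (verts G)" by (simp add: sum_distrib_left)
  finally show False by simp
qed

section \<open>Components and cycles of symmetric digraphs\<close>

text \<open>All of \<open>S\<close> lies in the strong component of \<open>t\<close>; since
  \<open>S\<close> is nonempty, \<open>t\<close> is indeed a vertex of \<open>H\<close>.\<close>

lemma card_le_star:
  assumes "fin_digraph H" and "\<And>v. v \<in> S \<Longrightarrow> t \<rightarrow>\<^sup>*\<^bsub>H\<^esub> v \<and> v \<rightarrow>\<^sup>*\<^bsub>H\<^esub> t" and "S \<noteq> {}"
  shows "card S \<le> star H"
proof -
  interpret fin_digraph H by fact
  have "t \<in> verts H" using assms(2,3) by (auto elim: reachable_in_vertsE)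
  then have "scc_of t \<in> sccs_verts" by (rule scc_of_in_sccs_verts)
  then have mem: "scc_of t \<in> verts ` sccs" by (simp add: sccs_verts_conv)
  have "S \<subseteq> scc_of t" using assms(2) by (auto simp: scc_of_def)
  moreover have "finite (scc_of t)"
    by (rule finite_subset[OF _ finite_verts]) (auto simp: scc_of_def elim: reachable_in_vertsE)
  ultimately have "card S \<le> card (scc_of t)" by (rule card_mono[rotated])
  also have "(\<lambda>H. card (verts H)) ` sccs = card ` sccs_verts"
    by (simp add: sccs_verts_conv image_image)
  then have "finite ((\<lambda>H. card (verts H)) ` sccs)" using finite_sccs_verts by simp
  then have "card (scc_of t) \<le> star H"
    unfolding star_def using mem by (intro Max_ge) auto
  finally show ?thesis .
qed

lemma pcas_nth:
  assumes "pcas u p v" "i < length p"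
  shows "snd (p ! i) = (if Suc i < length p then fst (p ! Suc i) else v)"
  using assms
proof (induction p arbitrary: u i)
  case (Cons e p)
  then show ?case by (cases i; cases p) auto
qed simp

text \<open>An arc of a cycle that enters a vertex of maximal level and the next arc would both join
  this vertex to its unique neighbour of smaller level.\<close>

lemma no_long_cycle:
  fixes lev :: "'a \<Rightarrow> nat"
  assumes arcs: "\<And>x y. (x, y) \<in> parcs G \<Longrightarrow>
      par y = x \<and> lev x < lev y \<or> par x = y \<and> lev y < lev x"
  shows "\<not> (\<exists>p. pre_digraph.cycle (with_proj G) p \<and> 3 \<le> length p)"
proof
  assume "\<exists>p. pre_digraph.cycle (with_proj G) p \<and> 3 \<le> length p"
  then obtain p u where cas: "pcas u p u" and sub: "set p \<subseteq> parcs G"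
    and dist: "distinct (tl (pawalk_verts u p))" and k: "3 \<le> length p"
    by (auto simp: pre_digraph.cycle_def pre_digraph.awalk_def cas_with_proj_eq awalk_verts_with_proj_eq)
  let ?k = "length p"
  have "tl (pawalk_verts u p) = map snd p"
    using pre_digraph.awalk_verts_conv'[of "with_proj G" u p u] cas k
    by (auto simp: cas_with_proj_eq awalk_verts_with_proj_eq)
  then have dist: "distinct (map snd p)" using dist by simp
  have "fst (p ! 0) = u" using cas k by (cases p) auto
  then have nxt: "snd (p ! i) = fst (p ! (Suc i mod ?k))" if "i < ?k" for i
    using pcas_nth[OF cas that] that by (cases "Suc i = ?k") auto
  have "finite ((\<lambda>i. lev (snd (p ! i))) ` {..<?k})" "(\<lambda>i. lev (snd (p ! i))) ` {..<?k} \<noteq> {}"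
    using k by (auto simp: lessThan_empty_iff)
  from Max_in[OF this] obtain i where i: "i < ?k"
    and M: "(MAX i\<in>{..<?k}. lev (snd (p ! i))) = lev (snd (p ! i))"
    by auto
  have max: "lev (snd (p ! j)) \<le> lev (snd (p ! i))" if "j < ?k" for j
    using that by (auto simp: M [symmetric])
  define h where "h = (if i = 0 then ?k - 1 else i - 1)"
  define j where "j = Suc i mod ?k"
  have h: "h < ?k" "Suc h mod ?k = i" using i k by (auto simp: h_def)
  have j: "j < ?k" unfolding j_def by (rule mod_less_divisor) (use k in linarith)
  \<comment> \<open>The arcs \<open>h\<close> and \<open>j\<close> are the cyclic predecessor and
    successor of arc \<open>i\<close>. They differ because the length is at least 3; on an edge
    traversed back and forth they would coincide.\<close>
  have hj: "h \<noteq> j" using i k by (cases "Suc i = ?k") (auto simp: h_def j_def)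
  have mem: "(fst (p ! l), snd (p ! l)) \<in> parcs G" if "l < ?k" for l
    using sub that by (auto dest: nth_mem)
  have "fst (p ! i) = snd (p ! h)" using nxt[OF h(1)] h(2) by simp
  then have "par (snd (p ! i)) = snd (p ! h)"
    using arcs[OF mem[OF i]] max[OF h(1)] by auto
  moreover have "fst (p ! j) = snd (p ! i)" using nxt[OF i] by (simp add: j_def)
  then have "par (snd (p ! i)) = snd (p ! j)"
    using arcs[OF mem[OF j]] max[OF j] by auto
  ultimately have "map snd p ! h = map snd p ! j" using h j by simp
  then show False using nth_eq_iff_index_eq[OF dist, of h j] h(1) j hj by simp
qed

section \<open>The complete tree as a graph\<close>

text \<open>The vertex type is an arbitrary infinite one, so words are carried into it by an
  injection \<open>\<phi>\<close>.\<close>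

definition word_tree :: "(nat list \<Rightarrow> 'a) \<Rightarrow> nat \<Rightarrow> nat \<Rightarrow> 'a pair_pre_digraph" where
  "word_tree \<phi> d n = \<lparr> pverts = \<phi> ` words d n,
     parcs = {(\<phi> w, \<phi> (x # w)) | x w. x # w \<in> words d n}
           \<union> {(\<phi> (x # w), \<phi> w) | x w. x # w \<in> words d n} \<rparr>"

lemma word_tree_simps [simp]:
  "pverts (word_tree \<phi> d n) = \<phi> ` words d n"
  "parcs (word_tree \<phi> d n) = {(\<phi> w, \<phi> (x # w)) | x w. x # w \<in> words d n}
           \<union> {(\<phi> (x # w), \<phi> w) | x w. x # w \<in> words d n}"
  by (simp_all add: word_tree_def)

context
  fixes \<phi> :: "nat list \<Rightarrow> 'a" and d n :: nat
  assumes inj: "inj \<phi>"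
begin

lemma pair_graph_word_tree: "pair_graph (word_tree \<phi> d n)"
proof
  have "parcs (word_tree \<phi> d n) \<subseteq> \<phi> ` words d n \<times> \<phi> ` words d n"
    by (auto dest: words_ConsD)
  then show "finite (parcs (word_tree \<phi> d n))"
    by (rule finite_subset) simp
  show "symmetric (with_proj (word_tree \<phi> d n))"
    by (auto simp: symmetric_def sym_def)
qed (auto dest: words_ConsD simp: inj_eq[OF inj])

text \<open>Each further letter of \<open>u\<close> adds one edge whose two ends avoid
  \<open>Y\<close>, and both orientations of that edge survive in the induced subgraph.\<close>

lemma word_tree_reachable_below:
  assumes "Y \<subseteq> \<phi> ` words d n" and u: "u \<in> below (words d n - \<phi> -` Y) t"
  shows "\<phi> t \<rightarrow>\<^sup>*\<^bsub>with_proj (word_tree \<phi> d n) \<restriction> (\<phi> ` words d n - Y)\<^esub> \<phi> (u @ t)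
       \<and> \<phi> (u @ t) \<rightarrow>\<^sup>*\<^bsub>with_proj (word_tree \<phi> d n) \<restriction> (\<phi> ` words d n - Y)\<^esub> \<phi> t"
proof -
  let ?H = "with_proj (word_tree \<phi> d n) \<restriction> (\<phi> ` words d n - Y)"
  interpret G: pair_graph "word_tree \<phi> d n" by (rule pair_graph_word_tree)
  interpret H: wf_digraph ?H by (rule G.wellformed_induce_subgraph)
  show ?thesis using u
  proof (induction u)
    case Nil
    then show ?case by (auto simp: below_def)
  next
    case (Cons x u)
    note IH = Cons.IH[OF below_ConsD[OF Cons.prems]]
    have "x # u @ t \<in> words d n - \<phi> -` Y" "u @ t \<in> words d n - \<phi> -` Y"
      using below_in[OF Cons.prems] below_in[OF below_ConsD[OF Cons.prems]] by auto
    then have "(\<phi> (u @ t), \<phi> (x # u @ t)) \<in> arcs_ends ?H" "(\<phi> (x # u @ t), \<phi> (u @ t)) \<in> arcs_ends ?H"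
      by (auto simp: arcs_ends_conv image_iff)
    with IH show ?case
      by (auto intro: H.reachable_adj_trans H.adj_reachable_trans)
  qed
qed

text \<open>Any two vertices are joined through the root. For \<open>no_long_cycle\<close>, the
  level is the length of the word and the parent its tail.\<close>

lemma undirected_tree_word_tree:
  assumes "n > 0"
  shows "undirected_tree (with_proj (word_tree \<phi> d n))"
proof -
  let ?G = "word_tree \<phi> d n"
  interpret G: pair_graph ?G by (rule pair_graph_word_tree)
  have root: "\<phi> [] \<rightarrow>\<^sup>*\<^bsub>with_proj ?G\<^esub> \<phi> w \<and> \<phi> w \<rightarrow>\<^sup>*\<^bsub>with_proj ?G\<^esub> \<phi> []" if "w \<in> words d n" for w
    using that
  proof (induction w)
    case (Cons x w)
    have "(\<phi> w, \<phi> (x # w)) \<in> parcs ?G" "(\<phi> (x # w), \<phi> w) \<in> parcs ?G"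
      using Cons.prems by auto
    with Cons.IH[OF words_ConsD[OF Cons.prems]] show ?case
      using G.reachable_adj_trans G.adj_reachable_trans by blast
  qed auto
  have "pverts ?G \<noteq> {}"
    using assms by (auto simp: words_def intro!: exI[of _ "[]"])
  moreover have "x \<rightarrow>\<^sup>*\<^bsub>with_proj ?G\<^esub> y" if "x \<in> pverts ?G" "y \<in> pverts ?G" for x y
    using that root by (auto intro: G.reachable_trans[of _ "\<phi> []"])
  ultimately have "Digraph_Component.connected (with_proj ?G)"
    unfolding connected_def strongly_connected_def
    by (auto intro!: G.reachable_mk_symmetricI)
  moreover have "\<not> (\<exists>p. pre_digraph.cycle (with_proj ?G) p \<and> 3 \<le> length p)"
    by (rule no_long_cycle[where par = "\<lambda>y. \<phi> (tl (inv \<phi> y))" and lev = "\<lambda>y. length (inv \<phi> y)"])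
      (use inj in auto)
  ultimately show ?thesis by (simp add: undirected_tree_def)
qed

lemma max_degree_word_tree: "max_degree (with_proj (word_tree \<phi> d n)) \<le> Suc d"
proof -
  let ?G = "word_tree \<phi> d n"
  have "out_degree (with_proj ?G) v \<le> Suc d" if "v \<in> pverts ?G" for v
  proof -
    obtain w where v: "v = \<phi> w" using \<open>v \<in> pverts ?G\<close> by auto
    \<comment> \<open>One arc leads to the parent and at most \<open>d\<close> to children. At the
      root \<open>tl [] = []\<close>, so the inserted pair is a loop and not an arc; only an
      inclusion is claimed.\<close>
    have "out_arcs (with_proj ?G) v \<subseteq> insert (v, \<phi> (tl w)) ((\<lambda>x. (v, \<phi> (x # w))) ` {..<d})"
      using inj by (auto simp: out_arcs_def v inj_eq words_def)
    then have "card (out_arcs (with_proj ?G) v)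
        \<le> card (insert (v, \<phi> (tl w)) ((\<lambda>x. (v, \<phi> (x # w))) ` {..<d}))"
      by (intro card_mono) auto
    also have "\<dots> \<le> Suc (card ((\<lambda>x. (v, \<phi> (x # w))) ` {..<d}))"
      by (rule card_insert_le_m1) simp_all
    also have "\<dots> \<le> Suc d" using card_image_le[of "{..<d}"] by force
    finally show ?thesis by (simp add: out_degree_def)
  qed
  then show ?thesis by (auto simp: max_degree_def)
qed

text \<open>This carries \<open>weight_separator\<close> over to the graph: the image of
  \<open>below\<close> at \<open>t\<close> lies in one component, so \<open>star\<close> bounds its
  size.\<close>

lemma weight_word_tree_separator:
  assumes "d > 0" "m > 0" "Y \<subseteq> \<phi> ` words d n"
    and star: "star (with_proj (word_tree \<phi> d n) \<restriction> (\<phi> ` words d n - Y)) \<le> d ^ (m - 1)"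
  shows "real n \<le> (\<Sum>y\<in>Y. wt d (inv \<phi> y)) + real m * (1 + (\<Sum>y\<in>Y. wt d (inv \<phi> y)))"
proof -
  let ?Z = "\<phi> -` Y"
  interpret G: pair_graph "word_tree \<phi> d n" by (rule pair_graph_word_tree)
  have "sum (wt d) ?Z = (\<Sum>y\<in>Y. wt d (inv \<phi> y))"
    using assms(3) inj by (intro sum.reindex_bij_witness[of _ "inv \<phi>" \<phi>]) auto
  moreover have "real n \<le> sum (wt d) ?Z + real m * (1 + sum (wt d) ?Z)"
  proof (rule weight_separator)
    show "?Z \<subseteq> words d n" using assms(3) inj by (auto dest: injD)
  next
    let ?H = "with_proj (word_tree \<phi> d n) \<restriction> (\<phi> ` words d n - Y)"
    fix t assume t: "t \<in> words d n - ?Z"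
    have "card (below (words d n - ?Z) t) = card ((\<lambda>u. \<phi> (u @ t)) ` below (words d n - ?Z) t)"
      by (intro card_image [symmetric] inj_onI) (simp add: inj_eq[OF inj])
    also have "\<dots> \<le> star ?H"
    proof (rule card_le_star)
      show "fin_digraph ?H"
        by (rule wf_digraph.fin_digraphI[OF G.wellformed_induce_subgraph])
          (auto simp del: word_tree_simps(2) intro: finite_subset[OF _ G.pair_finite_arcs])
      have "[] \<in> below (words d n - ?Z) t" using t by (auto simp: below_def)
      then show "(\<lambda>u. \<phi> (u @ t)) ` below (words d n - ?Z) t \<noteq> {}" by blast
    qed (use word_tree_reachable_below[OF assms(3)] in blast)
    also note star
    finally show "card (below (words d n - ?Z) t) \<le> d ^ (m - 1)" .
  qed (use assms in auto)
  ultimately show ?thesis by simp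
qed

end

section \<open>Choice of parameters and contradiction\<close>

theorem theorem13:
  fixes \<Delta> :: nat
    and \<G> :: "'a::infinite pair_pre_digraph set"
    and r :: "nat \<Rightarrow> real"
  assumes "\<Delta> \<ge> 3"
    and "\<And>G. G \<in> \<G> \<Longrightarrow> pair_graph G"
    and "\<And>T. pair_graph T \<Longrightarrow> undirected_tree (with_proj T) \<Longrightarrow>
           max_degree (with_proj T) \<le> \<Delta> \<Longrightarrow> T \<in> \<G>"
    and "mono r"
    and "\<And>n. r n \<ge> 0"
    and "class_fractionally_fragile (\<lambda>G. real (star G)) r \<G>"
  shows "\<forall>a::nat. a \<ge> 4 \<longrightarrow> r a \<ge> (real \<Delta> - 1) ^ (a - 3)"
proof (intro allI impI, rule ccontr)
  fix a :: nat
  assume a: "a \<ge> 4" and "\<not> r a \<ge> (real \<Delta> - 1) ^ (a - 3)"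
  define d where "d = \<Delta> - 1"
  have d: "d > 0" "Suc d = \<Delta>" "real \<Delta> - 1 = real d" using assms(1) by (auto simp: d_def)
  then have ra: "r a < real (d ^ (a - 3))" using \<open>\<not> _\<close> by simp
  \<comment> \<open>An infinite type contains a copy of the naturals, hence of the countable set of
    words.\<close>
  obtain f :: "nat \<Rightarrow> 'a" where f: "inj f"
    using infinite_countable_subset[OF infinite_UNIV] by blast
  define \<phi> :: "nat list \<Rightarrow> 'a" where "\<phi> = f \<circ> to_nat"
  have inj: "inj \<phi>" unfolding \<phi>_def using f by (intro inj_compose) auto
  define n where "n = a * a"
  have n: "n > 0" using a by (simp add: n_def)
  let ?G = "word_tree \<phi> d n"
  have "?G \<in> \<G>"
    using assms(3) pair_graph_word_tree[OF inj] undirected_tree_word_tree[OF inj n]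
      max_degree_word_tree[OF inj] d(2) by metis
  then have "fractionally_fragile (\<lambda>G. real (star G)) r (with_proj ?G)"
    using assms(6) by (simp add: class_fractionally_fragile_def)
  then have "\<exists>p. thin_distribution (with_proj ?G) (1 / real a) p \<and>
      (\<forall>Y\<in>set_pmf p. real (star (with_proj ?G \<restriction> (\<phi> ` words d n - Y))) \<le> r a)"
    using a unfolding fractionally_fragile_def by simp
  then obtain p where p: "thin_distribution (with_proj ?G) (1 / real a) p"
    and star: "\<And>Y. Y \<in> set_pmf p \<Longrightarrow> real (star (with_proj ?G \<restriction> (\<phi> ` words d n - Y))) \<le> r a"
    by blast
  obtain Y where Y: "Y \<in> set_pmf p"
    and light: "(\<Sum>y\<in>Y. wt d (inv \<phi> y)) \<le> 1 / real a * (\<Sum>y\<in>\<phi> ` words d n. wt d (inv \<phi> y))"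
    using thin_distribution_ex_light[OF _ p, of "\<lambda>y. wt d (inv \<phi> y)"] by auto
  have sub: "Y \<subseteq> \<phi> ` words d n" using p Y by (auto simp: thin_distribution_def)
  have "(\<Sum>y\<in>\<phi> ` words d n. wt d (inv \<phi> y)) = real n"
    using inj d(1) by (subst sum.reindex) (auto simp: sum_wt_words intro: inj_on_subset)
  then have light: "(\<Sum>y\<in>Y. wt d (inv \<phi> y)) \<le> real a" (is "?s \<le> _")
    using light a by (simp add: n_def)
  have "real (star (with_proj ?G \<restriction> (\<phi> ` words d n - Y))) < real (d ^ (a - 3))"
    using star[OF Y] ra by linarith
  \<comment> \<open>The exponent is written as \<open>m - 1\<close> with \<open>m = a - 2\<close>,
    which is positive since \<open>a \<ge> 4\<close>.\<close>
  then have "star (with_proj ?G \<restriction> (\<phi> ` words d n - Y)) \<le> d ^ (a - 2 - 1)"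
    by (simp del: of_nat_power add: numeral_eq_Suc)
  from weight_word_tree_separator[OF inj d(1) _ sub this]
  have "real n \<le> ?s + real (a - 2) * (1 + ?s)" using a by simp
  also have "\<dots> \<le> real a + real (a - 2) * (1 + real a)"
    using light by (intro add_mono mult_left_mono) auto
  also have "\<dots> = real n - 2"
    using a by (simp add: n_def algebra_simps)
  finally show False by simp
qed

end
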